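(* Let $\gamma$ be an infinite cardinal, let $\kappa=\gamma^+$ be its cardinal successor, and let $G$ be a group with $|G|\geqslant\kappa$. Then $G$ can be partitioned into $\gamma$ $(\kappa,1)$-thin subsets if and only if $|G|=\kappa$.
   Context: For a group $G$ and cardinals $\kappa,\mu$ with $|G|\geqslant\kappa\geqslant\aleph_0$ and $\mu\leqslant\kappa$, put $[G]^{<\kappa}=\{X\subset G: |X|<\kappa\}$. A subset $A\subseteq G$ is $(\kappa,\mu)$-thin if for every $F\in[G]^{<\kappa}$ there exists $K\in[G]^{<\kappa}$ such that $|Fg\cap A|\leqslant\mu$ for each $g\in G\setminus K$, where $Fg=\{fg: f\in F\}$. *)

theory Defs
  imports "HOL-Algebra.Coset" "HOL-Library.Disjoint_Sets"
begin

unbundle cardinal_syntax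

(* Cardinals are rendered as cardinal-order relations, compared up to =o. *)

definition small_subsets :: "('a, 'b) monoid_scheme \<Rightarrow> 'k rel \<Rightarrow> 'a set set" where
  "small_subsets G \<kappa> = {X. X \<subseteq> carrier G \<and> |X| <o \<kappa>}"

definition thin :: "('a, 'b) monoid_scheme \<Rightarrow> 'k rel \<Rightarrow> 'm rel \<Rightarrow> 'a set \<Rightarrow> bool" where
  "thin G \<kappa> \<mu> A \<longleftrightarrow>
     A \<subseteq> carrier G \<and>
     (\<forall>F \<in> small_subsets G \<kappa>. \<exists>K \<in> small_subsets G \<kappa>.
        \<forall>g \<in> carrier G - K. |(F #>\<^bsub>G\<^esub> g) \<inter> A| \<le>o \<mu>)"

end

theory Submission
  imports Defs "HOL-Algebra.Generated_Groups"
begin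

text \<open>Write \<open>\<kappa> = \<gamma>\<^sup>+\<close>.

  If \<open>|G| = \<kappa>\<close>, then \<open>G\<close> is the union of an increasing chain \<open>H i\<close>, \<open>i < \<kappa>\<close>, of subgroups
  of size at most \<open>\<gamma>\<close>. Call two elements equivalent if they lie in the same members of the
  chain. Each equivalence class is contained in some \<open>H i\<close>, so it has at most \<open>\<gamma>\<close> elements, and
  one can colour \<open>G\<close> by \<open>\<gamma>\<close> colours in such a way that equivalent elements receive different
  colours. By regularity of \<open>\<kappa>\<close>, a set \<open>F\<close> of size at most \<open>\<gamma>\<close> is contained in some \<open>H i\<close>, and
  if \<open>g\<close> lies outside \<open>H i\<close>, then left multiplication by an element of \<open>H i\<close> does not move \<open>g\<close>
  into or out of any member of the chain. Hence \<open>Fg\<close> lies in one equivalence class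
  and meets each colour class at most once: the colour classes are thin.

  If \<open>|G| > \<kappa>\<close> and \<open>G\<close> is partitioned into at most \<open>\<gamma>\<close> thin sets, fix \<open>S \<subseteq> G\<close> of size \<open>\<kappa>\<close>.
  Thinness of the classes for the two-element sets \<open>F = {s, t} \<subseteq> S\<close> excludes altogether at
  most \<open>\<kappa>\<close> elements, so some \<open>g\<close> is excluded by none of them. Then the elements of \<open>Sg\<close> lie in
  pairwise distinct classes, which gives \<open>\<kappa> \<le> \<gamma>\<close>, a contradiction.\<close>

section \<open>Chains of small subgroups\<close>

text \<open>The generated subgroup is exhausted by countably many sets: the symmetrised generating
  set with the unit is closed under multiplication by repeated squaring, and squaring keeps
  the size bound.\<close>

lemma (in group) card_of_generate_ordLeq:
  assumes inf: "Cinfinite r" and X: "X \<subseteq> carrier G" "|X| \<le>o r"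
  shows "|generate G X| \<le>o r"
proof -
  define W where "W = rec_nat (X \<union> m_inv G ` X \<union> {\<one>}) (\<lambda>_ Y. (\<lambda>(a, b). a \<otimes> b) ` (Y \<times> Y))"
  have W0: "W 0 = X \<union> m_inv G ` X \<union> {\<one>}"
    and WS: "\<And>n. W (Suc n) = (\<lambda>(a, b). a \<otimes> b) ` (W n \<times> W n)"
    by (simp_all add: W_def)
  have fin: "\<not> finite (Field r)" using inf by (simp add: cinfinite_def)
  have Wcarr: "W n \<subseteq> carrier G" for n
    by (induction n) (use X in \<open>auto simp: W0 WS\<close>)
  have Wone: "\<one> \<in> W n" for n
    by (induction n) (force simp: W0 WS)+
  have mono: "mono W"
  proof (rule mono_iff_le_Suc[THEN iffD2], intro allI subsetI)
    fix n x assume x: "x \<in> W n"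
    then have "x = x \<otimes> \<one>" using Wcarr[of n] by auto
    then show "x \<in> W (Suc n)" using x Wone[of n] unfolding WS by force
  qed
  have card: "|W n| \<le>o r" for n
  proof (induction n)
    case 0
    have "|m_inv G ` X| \<le>o r" using X(2) ordLeq_transitive[OF card_of_image] by blast
    moreover have "|{\<one>}| \<le>o r"
      using inf fin by (intro Card_order_singl_ordLeq) auto
    ultimately show ?case
      unfolding W0 using X inf fin by (intro card_of_Un_ordLeq_infinite_Field) auto
  next
    case (Suc n)
    have "|W n \<times> W n| \<le>o r"
      using Suc inf fin by (intro card_of_Times_ordLeq_infinite_Field) auto
    then show ?case unfolding WS using ordLeq_transitive[OF card_of_image] by blast
  qed
  have "generate G X \<subseteq> (\<Union>n. W n)"
  proof
    fix x assume "x \<in> generate G X"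
    then show "x \<in> (\<Union>n. W n)"
    proof induction
      case (eng h1 h2)
      then obtain m n where "h1 \<in> W m" "h2 \<in> W n" by blast
      then have "h1 \<in> W (max m n)" "h2 \<in> W (max m n)"
        using monoD[OF mono, of m "max m n"] monoD[OF mono, of n "max m n"] by auto
      then have "h1 \<otimes> h2 \<in> W (Suc (max m n))" unfolding WS by force
      then show ?case by blast
    qed (use W0 in blast)+
  qed
  moreover have "|\<Union>n. W n| \<le>o r"
    using inf fin card natLeq_ordLeq_cinfinite[of r]
    by (intro card_of_UNION_ordLeq_infinite_Field)
       (auto intro: ordIso_ordLeq_trans[OF card_of_nat])
  ultimately show ?thesis using card_of_mono1 ordLeq_transitive by blast
qed

text \<open>Enumerate the group along \<open>r\<^sup>+\<close> and generate by initial segments: a proper initial segment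
  of a cardinal is smaller than the cardinal, hence of size at most \<open>r\<close>.\<close>

lemma (in group) ex_chain_of_small_subgroups:
  assumes inf: "Cinfinite r" and card: "|carrier G| =o cardSuc r"
  obtains H where "relChain (cardSuc r) H" "\<And>i. subgroup (H i) G"
    "\<And>i. i \<in> Field (cardSuc r) \<Longrightarrow> |H i| \<le>o r"
    "carrier G = (\<Union>i\<in>Field (cardSuc r). H i)"
proof -
  let ?s = "cardSuc r"
  have s: "Card_order ?s" using inf cardSuc_Card_order by blast
  then have wo: "Well_order ?s" by (rule Card_order_wo_rel[unfolded wo_rel_def])
  have "|Field ?s| =o |carrier G|"
    using card card_of_Field_ordIso[OF s] ordIso_symmetric ordIso_transitive by blast
  then obtain e where e: "bij_betw e (Field ?s) (carrier G)"
    using card_of_ordIso by blast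
  define H where "H i = generate G (e ` ({j. (j, i) \<in> ?s}))" for i
  have sub: "e ` {j. (j, i) \<in> ?s} \<subseteq> carrier G" for i
    using e by (auto simp: bij_betw_def Field_def)
  show ?thesis
  proof
    show "relChain ?s H"
      unfolding relChain_def H_def
      using wo by (intro allI impI mono_generate)
        (auto simp: order_on_defs dest: transD)
    show "subgroup (H i) G" for i
      unfolding H_def by (rule generate_is_subgroup[OF sub])
    show "|H i| \<le>o r" if i: "i \<in> Field ?s" for i
    proof -
      have "|underS ?s i| \<le>o r"
        using card_of_underS[OF s i] cardSuc_ordLeq_ordLess[OF _ card_of_Card_order] inf by blast
      moreover have "|{i}| \<le>o r"
        using inf by (intro Card_order_singl_ordLeq) (auto simp: cinfinite_def)
      ultimately have "|underS ?s i \<union> {i}| \<le>o r"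
        using inf by (intro card_of_Un_ordLeq_infinite_Field) (auto simp: cinfinite_def)
      moreover have "{j. (j, i) \<in> ?s} \<subseteq> underS ?s i \<union> {i}"
        by (auto simp: underS_def)
      ultimately have "|{j. (j, i) \<in> ?s}| \<le>o r"
        by (rule ordLeq_transitive[OF card_of_mono1, rotated])
      then have "|e ` {j. (j, i) \<in> ?s}| \<le>o r"
        using ordLeq_transitive[OF card_of_image] by blast
      then show ?thesis
        unfolding H_def using inf sub by (intro card_of_generate_ordLeq)
    qed
    show "carrier G = (\<Union>i\<in>Field ?s. H i)"
    proof
      show "carrier G \<subseteq> (\<Union>i\<in>Field ?s. H i)"
      proof
        fix x assume "x \<in> carrier G"
        then obtain i where i: "i \<in> Field ?s" "x = e i"
          using e by (auto simp: bij_betw_def)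
        then have "(i, i) \<in> ?s"
          using wo by (auto simp: order_on_defs refl_on_def)
        then have "x \<in> H i"
          unfolding H_def i(2) by (intro generate.incl imageI) simp
        then show "x \<in> (\<Union>i\<in>Field ?s. H i)" using i by blast
      qed
      show "(\<Union>i\<in>Field ?s. H i) \<subseteq> carrier G"
        unfolding H_def using generate_incl[OF sub] by blast
    qed
  qed
qed

section \<open>Thin colour classes in a group of size \<open>\<gamma>\<^sup>+\<close>\<close>

text \<open>For an increasing chain this up-closed set of indices carries the same information as its
  least element, and equality of levels can be compared index by index.\<close>

definition level :: "'i set \<Rightarrow> ('i \<Rightarrow> 'a set) \<Rightarrow> 'a \<Rightarrow> 'i set" where
  "level I H g = {i \<in> I. g \<in> H i}"

text \<open>Below \<open>i\<close>, neither \<open>g\<close> nor \<open>f \<otimes> g\<close> is in the chain, as both avoid \<open>H i\<close>; from \<open>i\<close> on,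
  \<open>f\<close> is in the subgroup, so that the two elements enter it together.\<close>

lemma (in group) level_mult_left:
  assumes r: "Well_order r" and chain: "relChain r H" and sub: "\<And>i. subgroup (H i) G"
    and i: "i \<in> Field r" and f: "f \<in> H i" and g: "g \<in> carrier G" "g \<notin> H i"
  shows "level (Field r) H (f \<otimes> g) = level (Field r) H g"
proof -
  have fg: "f \<otimes> g \<in> H j \<longleftrightarrow> g \<in> H j" if fj: "f \<in> H j" for j
  proof
    have fc: "f \<in> carrier G" using fj sub subgroup.mem_carrier by metis
    show "g \<in> H j" if "f \<otimes> g \<in> H j"
    proof -
      have "inv f \<otimes> (f \<otimes> g) \<in> H j"
        using that fj sub[of j] by (simp add: subgroup.m_closed subgroup.m_inv_closed)
      then show ?thesis using fc g(1) by (simp add: m_assoc[symmetric])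
    qed
  qed (use fj sub in \<open>simp add: subgroup.m_closed\<close>)
  have "f \<otimes> g \<in> H j \<longleftrightarrow> g \<in> H j" if j: "j \<in> Field r" for j
  proof (cases "(i, j) \<in> r")
    case True
    then have "f \<in> H j" using chain f unfolding relChain_def by blast
    then show ?thesis by (rule fg)
  next
    case False
    then have "(j, i) \<in> r"
      using r i j wo_rel.TOTALS[of r] unfolding wo_rel_def by blast
    then have "H j \<subseteq> H i" using chain unfolding relChain_def by blast
    then show ?thesis using fg[OF f] g(2) by blast
  qed
  then show ?thesis unfolding level_def by blast
qed

text \<open>Regularity of \<open>r\<^sup>+\<close>, in the form of \<open>cardSuc_UNION\<close>, puts \<open>F\<close> into a single \<open>H i\<close>, which
  serves as the exceptional set: for \<open>g\<close> outside it, \<open>Fg\<close> is confined to one level, on which the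
  colouring \<open>k\<close> is injective.\<close>

lemma thin_fibre:
  assumes G: "group G" and inf: "Cinfinite r"
    and chain: "relChain (cardSuc r) H" and sub: "\<And>i. subgroup (H i) G"
    and small: "\<And>i. i \<in> Field (cardSuc r) \<Longrightarrow> |H i| \<le>o r"
    and un: "carrier G = (\<Union>i\<in>Field (cardSuc r). H i)"
    and inj: "\<And>a b. \<lbrakk>a \<in> carrier G; b \<in> carrier G; k a = k b;
      level (Field (cardSuc r)) H a = level (Field (cardSuc r)) H b\<rbrakk> \<Longrightarrow> a = b"
  shows "thin G (cardSuc r) cone {a \<in> carrier G. k a = z}"
  unfolding thin_def
proof (intro conjI ballI)
  interpret group G by fact
  let ?s = "cardSuc r" and ?A = "{a \<in> carrier G. k a = z}"
  have s: "Card_order ?s" using inf cardSuc_Card_order by blast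
  then have wo: "Well_order ?s" by (rule Card_order_wo_rel[unfolded wo_rel_def])
  have less: "|Y :: 'a set| <o ?s \<longleftrightarrow> |Y| \<le>o r" for Y
    using cardSuc_ordLeq_ordLess[OF _ card_of_Card_order] inf by blast
  fix F assume F: "F \<in> small_subsets G ?s"
  then obtain i where i: "i \<in> Field ?s" "F \<subseteq> H i"
    using cardSuc_UNION[OF _ _ chain, of F] inf un less
    unfolding small_subsets_def cinfinite_def by blast
  show "\<exists>K\<in>small_subsets G ?s. \<forall>g\<in>carrier G - K. |(F #>\<^bsub>G\<^esub> g) \<inter> ?A| \<le>o cone"
  proof (intro bexI ballI)
    show "H i \<in> small_subsets G ?s"
      using small[OF i(1)] less subgroup.subset[OF sub] unfolding small_subsets_def by blast
    fix g assume g: "g \<in> carrier G - H i"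
    have "level (Field ?s) H x = level (Field ?s) H g" if "x \<in> F #>\<^bsub>G\<^esub> g" for x
      using that i g level_mult_left[OF wo chain sub i(1)] unfolding r_coset_def by blast
    then have "inj_on (\<lambda>_. ()) ((F #>\<^bsub>G\<^esub> g) \<inter> ?A)"
      using inj by (intro inj_onI) auto
    then show "|(F #>\<^bsub>G\<^esub> g) \<inter> ?A| \<le>o cone"
      unfolding cone_def using card_of_ordLeq[THEN iffD1] by blast
  qed
qed auto

text \<open>A level is contained in a member of the chain, so it can be coloured injectively.\<close>

lemma ex_colouring_inj_on_levels:
  fixes r :: "'c rel"
  assumes r: "Card_order r" and small: "\<And>i. i \<in> I \<Longrightarrow> |H i| \<le>o r"
    and un: "A = (\<Union>i\<in>I. H i)"
  obtains c where "c ` A \<subseteq> Field r"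
    "\<And>a b. \<lbrakk>a \<in> A; b \<in> A; c a = c b; level I H a = level I H b\<rbrakk> \<Longrightarrow> a = b"
proof -
  let ?E = "\<lambda>L. {a \<in> A. level I H a = L}"
  have "\<exists>h. inj_on h (?E L) \<and> h ` ?E L \<subseteq> Field r" for L
  proof (cases "?E L = {}")
    case False
    then obtain i where i: "i \<in> I" "i \<in> L" unfolding un level_def by blast
    then have "?E L \<subseteq> H i" unfolding level_def by blast
    then have "|?E L| \<le>o r" using small[OF i(1)] card_of_mono1 ordLeq_transitive by blast
    then have "|?E L| \<le>o |Field r|"
      using card_of_Field_ordIso[OF r] ordIso_symmetric ordLeq_ordIso_trans by blast
    then show ?thesis using card_of_ordLeq[THEN iffD2] by blast
  qed (simp only: inj_on_empty image_empty, blast)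
  then obtain h where h: "\<And>L. inj_on (h L) (?E L)" "\<And>L. h L ` ?E L \<subseteq> Field r" by metis
  show ?thesis
  proof (rule that[of "\<lambda>a. h (level I H a) a"])
    show "(\<lambda>a. h (level I H a) a) ` A \<subseteq> Field r" using h(2) by blast
    fix a b assume "a \<in> A" "b \<in> A" "h (level I H a) a = h (level I H b) b"
      "level I H a = level I H b"
    then show "a = b" using inj_onD[OF h(1)[of "level I H b"], of a b] by simp
  qed
qed

lemma partition_on_fibres: "partition_on A ((\<lambda>z. {a \<in> A. k a = z}) ` k ` A)"
  by (rule partition_onI) (auto simp: disjnt_iff)

lemma card_of_fibres: "|(\<lambda>z. {a \<in> A. k a = z}) ` k ` A| =o |k ` A|"
proof -
  have "inj_on (\<lambda>z. {a \<in> A. k a = z}) (k ` A)" by (auto simp: inj_on_def)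
  then have "bij_betw (\<lambda>z. {a \<in> A. k a = z}) (k ` A) ((\<lambda>z. {a \<in> A. k a = z}) ` k ` A)"
    by (rule inj_on_imp_bij_betw)
  then show ?thesis using card_of_ordIsoI ordIso_symmetric by blast
qed

lemma ex_thin_partition_if_card_eq_cardSuc:
  fixes r :: "'c rel"
  assumes G: "group G" and inf: "Cinfinite r" and card: "|carrier G| =o cardSuc r"
  shows "\<exists>P. partition_on (carrier G) P \<and> |P| =o r \<and> (\<forall>A\<in>P. thin G (cardSuc r) cone A)"
proof -
  let ?L = "level (Field (cardSuc r))"
  have FI: "|Field r| =o r" using inf card_of_Field_ordIso by blast
  obtain H where H: "relChain (cardSuc r) H" "\<And>i. subgroup (H i) G"
    "\<And>i. i \<in> Field (cardSuc r) \<Longrightarrow> |H i| \<le>o r"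
    "carrier G = (\<Union>i\<in>Field (cardSuc r). H i)"
    using group.ex_chain_of_small_subgroups[OF G inf card] by blast
  obtain c where c: "c ` carrier G \<subseteq> Field r"
    "\<And>a b. \<lbrakk>a \<in> carrier G; b \<in> carrier G; c a = c b; ?L H a = ?L H b\<rbrakk> \<Longrightarrow> a = b"
    using ex_colouring_inj_on_levels[of r "Field (cardSuc r)" H "carrier G"] H inf by metis
  have "|Field r| \<le>o cardSuc r"
    using inf cardSuc_ordLeq FI ordIso_ordLeq_trans by blast
  then have "|Field r| \<le>o |carrier G|"
    using card ordIso_symmetric ordLeq_ordIso_trans by blast
  moreover have "Field r \<noteq> {}" using inf unfolding cinfinite_def by auto
  ultimately obtain d where d: "d ` carrier G = Field r"
    using card_of_ordLeq2[of "Field r" "carrier G"] by blast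
  (* The second component only ensures that no fewer than r colours are used. *)
  define k where "k a = (c a, d a)" for a
  let ?P = "(\<lambda>z. {a \<in> carrier G. k a = z}) ` k ` carrier G"
  have "k ` carrier G \<subseteq> Field r \<times> Field r" using c(1) d by (auto simp: k_def)
  moreover have "|Field r \<times> Field r| \<le>o r"
    using inf FI unfolding cinfinite_def
    by (intro card_of_Times_ordLeq_infinite_Field) (auto intro: ordIso_imp_ordLeq)
  ultimately have "|k ` carrier G| \<le>o r" using card_of_mono1 ordLeq_transitive by blast
  moreover have "r \<le>o |k ` carrier G|"
  proof -
    have "Field r = snd ` k ` carrier G" using d by (auto simp: k_def image_image)
    then have "|Field r| \<le>o |k ` carrier G|" using card_of_image by metis
    then show ?thesis using FI ordIso_symmetric ordIso_ordLeq_trans by blast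
  qed
  ultimately have "|?P| =o r"
    using card_of_fibres ordIso_iff_ordLeq ordIso_transitive by blast
  moreover have "thin G (cardSuc r) cone A" if A: "A \<in> ?P" for A
  proof -
    obtain z where "A = {a \<in> carrier G. k a = z}" using A by blast
    moreover have "thin G (cardSuc r) cone {a \<in> carrier G. k a = z}"
      using c(2) by (intro thin_fibre[OF G inf H]) (auto simp: k_def)
    ultimately show ?thesis by simp
  qed
  ultimately show ?thesis using partition_on_fibres by blast
qed

section \<open>Few thin classes bound the size of the group\<close>

lemma eq_if_card_of_ordLeq_cone:
  assumes "|X| \<le>o cone" "x \<in> X" "y \<in> X"
  shows "x = y"
proof -
  obtain f :: "'a \<Rightarrow> unit" where "inj_on f X"
    using assms(1) card_of_ordLeq[THEN iffD2, of X "{()}"] unfolding cone_def by blast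
  then show ?thesis using assms(2,3) by (auto dest: inj_onD)
qed

text \<open>An element \<open>g\<close> outside all exceptional sets of pairs makes \<open>u \<mapsto> class of u \<otimes> g\<close> injective on
  \<open>S\<close>. Only pairs are tested because there are \<open>r\<^sup>+\<close> of them, each with a small exceptional set
  for each of the \<open>r\<close> classes, so that the union of these sets cannot cover a larger group.\<close>

lemma (in group) card_le_cardSuc_if_thin_partition:
  fixes r :: "'c rel"
  assumes inf: "Cinfinite r"
    and P: "partition_on (carrier G) P" "|P| \<le>o r" "\<And>A. A \<in> P \<Longrightarrow> thin G (cardSuc r) cone A"
  shows "|carrier G| \<le>o cardSuc r"
proof (rule ccontr)
  let ?s = "cardSuc r"
  have s: "Card_order ?s" using inf cardSuc_Card_order by blast
  have fins: "\<not> finite (Field ?s)"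
    using inf cardSuc_finite unfolding cinfinite_def by blast
  have FI: "|Field ?s| =o ?s" by (rule card_of_Field_ordIso[OF s])
  assume "\<not> |carrier G| \<le>o ?s"
  then have big: "?s <o |carrier G|"
    using s card_of_Card_order not_ordLeq_iff_ordLess unfolding card_order_on_def
    by (metis card_of_Well_order)
  then have "|Field ?s| \<le>o |carrier G|"
    using FI ordIso_ordLeq_trans ordLess_imp_ordLeq by blast
  then obtain e where e: "inj_on e (Field ?s)" "e ` Field ?s \<subseteq> carrier G"
    using card_of_ordLeq[THEN iffD2] by blast
  define S where "S = e ` Field ?s"
  have SG: "S \<subseteq> carrier G" using e unfolding S_def by blast
  have cardS: "|S| =o ?s"
    unfolding S_def
    by (rule ordIso_transitive[OF ordIso_symmetric[OF card_of_ordIsoI] FI])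
       (rule inj_on_imp_bij_betw[OF e(1)])
  have F: "{u, v} \<in> small_subsets G ?s" if "u \<in> S" "v \<in> S" for u v
    using that SG fins s unfolding small_subsets_def
    by (auto intro!: finite_ordLess_infinite card_of_Well_order card_of_well_order_on simp: card_order_on_def Field_card_of)
  (* K A u v is the exceptional set that thinness of A provides for {u, v}. *)
  have "\<forall>A\<in>P. \<forall>u\<in>S. \<forall>v\<in>S. \<exists>K\<in>small_subsets G ?s.
      \<forall>g\<in>carrier G - K. |({u, v} #> g) \<inter> A| \<le>o cone"
    using P(3) F unfolding thin_def by blast
  then obtain K where K: "\<And>A u v. \<lbrakk>A \<in> P; u \<in> S; v \<in> S\<rbrakk> \<Longrightarrow> K A u v \<in> small_subsets G ?s"
    "\<And>A u v g. \<lbrakk>A \<in> P; u \<in> S; v \<in> S; g \<in> carrier G - K A u v\<rbrakk>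
      \<Longrightarrow> |({u, v} #> g) \<inter> A| \<le>o cone"
    by metis
  let ?I = "P \<times> S \<times> S"
  let ?U = "\<Union>(A, u, v)\<in>?I. K A u v"
  have "|P| \<le>o ?s" using P(2) inf cardSuc_ordLeq ordLeq_transitive by blast
  moreover have "|S| \<le>o ?s" using cardS ordIso_imp_ordLeq by blast
  ultimately have "|?I| \<le>o ?s"
    using s fins by (intro card_of_Times_ordLeq_infinite_Field)
  moreover have "|K A u v| \<le>o ?s" if "A \<in> P" "u \<in> S" "v \<in> S" for A u v
    using K(1)[OF that] ordLess_imp_ordLeq unfolding small_subsets_def by blast
  ultimately have "|?U| \<le>o ?s"
    using s fins by (intro card_of_UNION_ordLeq_infinite_Field) auto
  then have "|?U| <o |carrier G|" using big ordLeq_ordLess_trans by blast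
  then obtain g where g: "g \<in> carrier G" "g \<notin> ?U"
    by (metis card_of_mono1 not_ordLess_ordLeq subsetI)
  have "\<exists>A\<in>P. u \<otimes> g \<in> A" if "u \<in> S" for u
    using that SG g(1) partition_onD1[OF P(1)] by blast
  then obtain cl where cl: "\<And>u. u \<in> S \<Longrightarrow> cl u \<in> P" "\<And>u. u \<in> S \<Longrightarrow> u \<otimes> g \<in> cl u" by metis
  have "inj_on cl S"
  proof
    fix u v assume uv: "u \<in> S" "v \<in> S" "cl u = cl v"
    have "|({u, v} #> g) \<inter> cl u| \<le>o cone"
      using K(2)[of "cl u" u v g] cl uv g by blast
    moreover have "u \<otimes> g \<in> ({u, v} #> g) \<inter> cl u" "v \<otimes> g \<in> ({u, v} #> g) \<inter> cl u"
      using cl(2) uv unfolding r_coset_def by auto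
    ultimately have "u \<otimes> g = v \<otimes> g" by (rule eq_if_card_of_ordLeq_cone)
    then show "u = v" using uv SG g(1) right_cancel by blast
  qed
  then have "|S| \<le>o |P|" using cl(1) card_of_ordLeq[THEN iffD1] by blast
  then have "?s \<le>o r"
    using cardS P(2) ordIso_symmetric ordIso_ordLeq_trans ordLeq_transitive by blast
  then show False using inf cardSuc_greater not_ordLess_ordLeq by blast
qed

theorem theorem4:
  fixes G :: "('a, 'b) monoid_scheme" and \<gamma> :: "'c rel"
  assumes "group G"
    and "Card_order \<gamma>" and "cinfinite \<gamma>"
    and "cardSuc \<gamma> \<le>o |carrier G|"
  shows "(\<exists>P. partition_on (carrier G) P \<and> |P| =o \<gamma> \<and>
              (\<forall>A \<in> P. thin G (cardSuc \<gamma>) cone A))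
         \<longleftrightarrow> |carrier G| =o cardSuc \<gamma>"
proof
  assume "\<exists>P. partition_on (carrier G) P \<and> |P| =o \<gamma> \<and> (\<forall>A \<in> P. thin G (cardSuc \<gamma>) cone A)"
  then have "|carrier G| \<le>o cardSuc \<gamma>"
    using group.card_le_cardSuc_if_thin_partition[of G \<gamma>] assms ordIso_imp_ordLeq by blast
  then show "|carrier G| =o cardSuc \<gamma>" using assms(4) ordIso_iff_ordLeq by blast
next
  assume "|carrier G| =o cardSuc \<gamma>"
  then show "\<exists>P. partition_on (carrier G) P \<and> |P| =o \<gamma> \<and> (\<forall>A \<in> P. thin G (cardSuc \<gamma>) cone A)"
    using ex_thin_partition_if_card_eq_cardSuc[of G \<gamma>] assms by blast
qed

end
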